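(* Let $(\mathcal{X},d)$ be a complete metric space and $f\colon\mathcal{X}\to\mathbb{R}\cup\{+\infty\}$ a closed function. Consider a sequence of points $x_k\in\mathcal{X}$ with $f(x_k)$ finite and closed functions $f_{x_k}\colon\mathcal{X}\to\mathbb{R}\cup\{+\infty\}$ satisfying $f_{x_k}(x_{k+1})\leq\inf f_{x_k}+\epsilon_k$ for all $k$, for some sequence $\epsilon_k\to0$. Suppose that $$|f_{x_k}(y)-f(y)|\leq\omega(d(y,x_k))\quad\text{for all indices } k\text{ and all points } y\in\mathcal{X},$$ where $\omega$ is a proper growth function. Suppose moreover that the model improvements $f(x_k)-f_{x_k}(x_{k+1})$ tend to zero. If $(x^*,f(x^* ))\in\mathcal{X}\times\mathbb{R}$ is a limit point (i.e. the limit of a subsequence) of the sequence $(x_k,f(x_k))$, then $x^*$ is stationary for $f$.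
   Context: A function on a metric space is called closed if it is lower-semicontinuous. A growth function is a differentiable function $\omega\colon[0,\infty)\to[0,\infty)$ (one-sided derivative at $0$) with $\omega(0)=\omega'(0)=0$ and $\omega'>0$ on $(0,\infty)$; it is proper if in addition $\lim_{t\to0^+}\omega'(t)=\lim_{t\to 0^+}\omega(t)/\omega'(t)=0$. The slope of $f$ at a point $\bar x$ with $f(\bar x)$ finite is $|\nabla f|(\bar x):=\limsup_{x\to\bar x,\,x\ne\bar x}\frac{(f(\bar x)-f(x))^+}{d(\bar x,x)}$, where $r^+=\max\{0,r\}$ (it is $0$ if $\bar x$ is isolated). The limiting slope is $\overline{|\nabla f|}(\bar x):=\liminf_{x\to\bar x,\,f(x)\to f(\bar x)}|\nabla f|(x)$, where $x=\bar x$ is allowed in the liminf. A point $\bar x$ is stationary for $f$ if $\overline{|\nabla f|}(\bar x)=0$. The inequality $|f_{x_k}(y)-f(y)|\le\omega(d(y,x_k))$ is understood to mean that $f_{x_k}(y)$ and $f(y)$ are either both $+\infty$ or both finite and satisfying the inequality. *)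

theory Defs
  imports "HOL-Analysis.Analysis"
begin

text \<open>
  Functions into \<open>\<real> \<union> {+\<infinity>}\<close> are \<open>ereal\<close>-valued functions that avoid \<open>-\<infinity>\<close>; the latter condition
  is stated separately wherever it is needed.
\<close>

definition closed_function :: "('a::metric_space \<Rightarrow> ereal) \<Rightarrow> bool" where
  "closed_function f \<longleftrightarrow> (\<forall>x. f x \<le> Liminf (at x) f)"

text \<open>
  A function on \<open>[0,\<infinity>)\<close> is a total function whose values at negative arguments are never
  inspected: the derivative is taken within \<open>[0,\<infinity>)\<close>, hence it is one-sided at \<open>0\<close>.
\<close>

definition halfline_deriv :: "(real \<Rightarrow> real) \<Rightarrow> real \<Rightarrow> real" where
  "halfline_deriv \<omega> t = vector_derivative \<omega> (at t within {0..})"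

definition growth_function :: "(real \<Rightarrow> real) \<Rightarrow> bool" where
  "growth_function \<omega> \<longleftrightarrow>
     (\<forall>t\<ge>0. 0 \<le> \<omega> t) \<and> \<omega> differentiable_on {0..} \<and>
     \<omega> 0 = 0 \<and> halfline_deriv \<omega> 0 = 0 \<and> (\<forall>t>0. 0 < halfline_deriv \<omega> t)"

definition proper_growth_function :: "(real \<Rightarrow> real) \<Rightarrow> bool" where
  "proper_growth_function \<omega> \<longleftrightarrow> growth_function \<omega> \<and>
     (halfline_deriv \<omega> \<longlongrightarrow> 0) (at_right 0) \<and>
     ((\<lambda>t. \<omega> t / halfline_deriv \<omega> t) \<longlongrightarrow> 0) (at_right 0)"

text \<open>
  The slope is meaningful only at points where \<open>f\<close> is finite.  The case distinction is needed
  because \<open>Limsup\<close> along the trivial filter at an isolated point would be \<open>-\<infinity>\<close>.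
\<close>

definition slope :: "('a::metric_space \<Rightarrow> ereal) \<Rightarrow> 'a \<Rightarrow> ereal" where
  "slope f u =
     (if u islimpt UNIV
      then Limsup (at u) (\<lambda>x. max 0 (f u - f x) / ereal (dist u x))
      else 0)"

text \<open>
  The filter expresses \<open>x \<rightarrow> u\<close> and \<open>f x \<rightarrow> f u\<close>, with \<open>x = u\<close> allowed.  When \<open>f u\<close> is finite, \<open>f\<close> is
  finite at all points that are eventually considered.
\<close>

definition limiting_slope :: "('a::metric_space \<Rightarrow> ereal) \<Rightarrow> 'a \<Rightarrow> ereal" where
  "limiting_slope f u = Liminf (inf (nhds u) (filtercomap f (nhds (f u)))) (slope f)"

definition stationary :: "('a::metric_space \<Rightarrow> ereal) \<Rightarrow> 'a \<Rightarrow> bool" where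
  "stationary f u \<longleftrightarrow> \<bar>f u\<bar> \<noteq> \<infinity> \<and> limiting_slope f u = 0"

end

theory Submission
  imports Defs
begin

text \<open>
  Since \<open>f\<close> and the model agree at \<open>x\<^sub>k\<close>, the function \<open>f + \<omega>(d(\<cdot>, x\<^sub>k))\<close> majorizes the
  model and equals \<open>f x\<^sub>k\<close> at \<open>x\<^sub>k\<close>, so \<open>x\<^sub>k\<close> minimizes it up to the model improvement plus
  \<open>\<epsilon>\<^sub>k\<close>, a quantity tending to zero.  Ekeland's variational principle with a fixed rate \<open>\<rho>\<close>
  provides \<open>z\<^sub>k\<close> with \<open>d(z\<^sub>k, x\<^sub>k) \<rightarrow> 0\<close> and \<open>f z\<^sub>k \<le> f x\<^sub>k\<close>, at which the slope of \<open>f\<close> is at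
  most \<open>\<rho> + \<omega>'(d(z\<^sub>k, x\<^sub>k))\<close>.  Along the subsequence, \<open>f z\<^sub>k \<rightarrow> f x\<^sup>*\<close> by lower semicontinuity.
\<close>

section \<open>Lower semicontinuity\<close>

lemma closed_function_iff:
  "closed_function f \<longleftrightarrow> (\<forall>u c. c < f u \<longrightarrow> (\<forall>\<^sub>F y in nhds u. c < f y))"
  \<comment> \<open>The premise \<open>c < f u\<close> covers the centre, so the punctured filter
    \<open>at u\<close> can be traded for \<open>nhds u\<close>.\<close>
  unfolding closed_function_def le_Liminf_iff eventually_nhds_conv_at by auto

lemma closed_function_limit_le:
  assumes "closed_function f" and "u \<longlonglongrightarrow> z" and "\<forall>\<^sub>F n in sequentially. f (u n) \<le> c"
  shows "f z \<le> c"
proof (rule ccontr)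
  assume "\<not> f z \<le> c"
  then have "\<forall>\<^sub>F y in nhds z. c < f y"
    using assms(1) unfolding closed_function_iff by auto
  then have "\<forall>\<^sub>F n in sequentially. c < f (u n)"
    using assms(2) by (rule eventually_compose_filterlim)
  with assms(3) have "\<forall>\<^sub>F n in sequentially. False"
    by eventually_elim auto
  then show False by simp
qed

lemma closed_function_add_continuous:
  fixes g :: "'a::metric_space \<Rightarrow> real"
  assumes f: "closed_function f" "\<And>y. f y \<noteq> -\<infinity>" and g: "continuous_on UNIV g"
  shows "closed_function (\<lambda>y. f y + ereal (g y))"
  unfolding closed_function_iff
proof (intro allI impI)
  fix u c assume c: "c < f u + ereal (g u)"
  show "\<forall>\<^sub>F y in nhds u. c < f y + ereal (g y)"
  proof (cases c)
    case (real r)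
    have "ereal (r - g u) < f u" using c real by (cases "f u") auto
    \<comment> \<open>The gap is split at a real \<open>a\<close>: near \<open>u\<close>,
      \<open>f\<close> stays above \<open>a\<close> and \<open>g\<close> above
      \<open>r - a\<close>.\<close>
    then obtain a where a: "ereal (r - g u) < ereal a" "ereal a < f u"
      using ereal_dense2 by blast
    have "(g \<longlongrightarrow> g u) (nhds u)"
      using g by (simp add: continuous_on_def tendsto_at_iff_tendsto_nhds)
    moreover have "r - a < g u" using a by simp
    ultimately have "\<forall>\<^sub>F y in nhds u. r - a < g y" by (rule order_tendstoD)
    moreover have "\<forall>\<^sub>F y in nhds u. ereal a < f y"
      using f(1) a(2) unfolding closed_function_iff by auto
    ultimately show ?thesis
    proof eventually_elim
      case (elim y)
      then show ?case using real by (cases "f y") auto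
    qed
  next
    case MInf
    then show ?thesis using f(2) by (simp add: ereal_less_eq less_le)
  qed (use c in auto)
qed

section \<open>Ekeland's variational principle in a complete metric space\<close>

theorem Ekeland_variational_principle:
  fixes \<phi> :: "'a::complete_space \<Rightarrow> ereal"
  assumes closed: "closed_function \<phi>" and bound: "\<And>y. ereal m \<le> \<phi> y"
    and fin: "\<phi> x0 \<noteq> \<infinity>" and \<rho>: "\<rho> > 0"
  obtains z where "\<phi> z + ereal (\<rho> * dist x0 z) \<le> \<phi> x0"
    and "\<And>y. y \<noteq> z \<Longrightarrow> \<phi> z < \<phi> y + ereal (\<rho> * dist z y)"
proof -
  \<comment> \<open>\<open>S u\<close> is the set of points below \<open>u\<close> in Ekeland's
    order. The goal amounts to \<open>z \<in> S x0\<close> and to \<open>S z\<close> having no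
    element besides \<open>z\<close>.\<close>
  define S where "S u = {y. \<phi> y + ereal (\<rho> * dist u y) \<le> \<phi> u}" for u
  \<comment> \<open>\<open>g\<close> permits real linear arithmetic. It is meaningful only where
    \<open>\<phi>\<close> is finite, a property that passes from \<open>u\<close> to all of
    \<open>S u\<close>.\<close>
  define g where "g = (\<lambda>u. real_of_ereal (\<phi> u))"
  have not_MInf: "\<phi> y \<noteq> -\<infinity>" for y using bound[of y] by auto
  have \<phi>_eq: "\<phi> u = ereal (g u)" if "\<phi> u \<noteq> \<infinity>" for u
    using that not_MInf[of u] by (cases "\<phi> u") (auto simp: g_def)
  have S_fin: "\<phi> v \<noteq> \<infinity>" if "\<phi> u \<noteq> \<infinity>" "v \<in> S u" for u v
    using that by (auto simp: S_def)
  have S_real: "g v + \<rho> * dist u v \<le> g u" if "\<phi> u \<noteq> \<infinity>" "v \<in> S u" for u v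
    using that \<phi>_eq[OF that(1)] \<phi>_eq[OF S_fin[OF that]] by (auto simp: S_def)
  have S_refl: "u \<in> S u" for u by (simp add: S_def flip: zero_ereal_def)
  have S_trans: "w \<in> S u" if "\<phi> u \<noteq> \<infinity>" "v \<in> S u" "w \<in> S v" for u v w
  proof -
    have "\<rho> * dist u w \<le> \<rho> * dist u v + \<rho> * dist v w"
      using \<rho> dist_triangle[of u w v] by (simp flip: distrib_left)
    then have "g w + \<rho> * dist u w \<le> g u"
      using S_real[OF that(1,2)] S_real[OF S_fin[OF that(1,2)] that(3)] by linarith
    then show ?thesis
      using \<phi>_eq[OF that(1)] \<phi>_eq[OF S_fin[OF S_fin[OF that(1,2)] that(3)]] by (simp add: S_def)
  qed
  \<comment> \<open>Minima over \<open>S u\<close> need not be attained, so the iteration takes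
    minimizers up to an error \<open>e\<close>, later \<open>(1/2) ^ n\<close>.\<close>
  have near_min: "\<exists>v. v \<in> S u \<and> (\<forall>w\<in>S u. g v \<le> g w + e)" if "\<phi> u \<noteq> \<infinity>" "e > 0" for u e
  proof -
    have bdd: "bdd_below (g ` S u)"
    proof (rule bdd_belowI2)
      fix v assume "v \<in> S u"
      then show "m \<le> g v" using bound[of v] \<phi>_eq[OF S_fin[OF that(1)]] by simp
    qed
    have "Inf (g ` S u) < Inf (g ` S u) + e" using that by simp
    then obtain v where v: "v \<in> S u" "g v < Inf (g ` S u) + e"
      using S_refl[of u] by (subst (asm) cInf_less_iff[OF _ bdd]) auto
    have "g v \<le> g w + e" if "w \<in> S u" for w
      using v(2) cINF_lower[OF bdd that] by linarith
    with v show ?thesis by blast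
  qed
  \<comment> \<open>The invariant of the choice carries finiteness and, through the clause for
    \<open>n = 0\<close>, the starting point.\<close>
  have "\<exists>u. \<forall>n. (\<phi> (u n) \<noteq> \<infinity> \<and> (n = 0 \<longrightarrow> u n = x0)) \<and>
      u (Suc n) \<in> S (u n) \<and> (\<forall>w\<in>S (u n). g (u (Suc n)) \<le> g w + (1/2) ^ n)"
  proof (rule dependent_nat_choice)
    show "\<exists>v. \<phi> v \<noteq> \<infinity> \<and> ((0::nat) = 0 \<longrightarrow> v = x0)" using fin by auto
  next
    fix v and n :: nat
    assume "\<phi> v \<noteq> \<infinity> \<and> (n = 0 \<longrightarrow> v = x0)"
    then show "\<exists>w. (\<phi> w \<noteq> \<infinity> \<and> (Suc n = 0 \<longrightarrow> w = x0)) \<and>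
        w \<in> S v \<and> (\<forall>w'\<in>S v. g w \<le> g w' + (1/2) ^ n)"
      using near_min[of v "(1/2) ^ n"] S_fin[of v] by auto
  qed
  then obtain u where u_fin: "\<And>n. \<phi> (u n) \<noteq> \<infinity>" and u0: "u 0 = x0"
    and u_S: "\<And>n. u (Suc n) \<in> S (u n)"
    and u_min: "\<And>n w. w \<in> S (u n) \<Longrightarrow> g (u (Suc n)) \<le> g w + (1/2) ^ n"
    by blast
  have u_le: "u k \<in> S (u n)" if "n \<le> k" for n k
    using that
  proof (induction rule: dec_induct)
    case (step k)
    then show ?case using S_trans[OF u_fin _ u_S] by blast
  qed (rule S_refl)
  \<comment> \<open>\<open>S (u (Suc n))\<close> lies in \<open>S (u n)\<close>, over which
    \<open>u (Suc n)\<close> is nearly minimal. Moving within it lowers \<open>g\<close> by at most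
    \<open>(1/2) ^ n\<close>, while distance costs at least \<open>\<rho>\<close> per unit. The
    index is \<open>Suc n\<close> because \<open>u 0\<close> is prescribed, not nearly
    minimal.\<close>
  have diam: "dist (u (Suc n)) w \<le> (1/2) ^ n / \<rho>" if "w \<in> S (u (Suc n))" for n w
  proof -
    have "g (u (Suc n)) \<le> g w + (1/2) ^ n" using u_min S_trans[OF u_fin u_S that] by blast
    with S_real[OF u_fin that] have "dist (u (Suc n)) w * \<rho> \<le> (1/2) ^ n"
      by (simp only: mult.commute[of _ \<rho>])
    then show ?thesis using \<rho> by (simp only: pos_le_divide_eq)
  qed
  have lim0: "(\<lambda>n. (1/2) ^ n / \<rho>) \<longlonglongrightarrow> 0"
    using tendsto_divide[OF LIMSEQ_power_zero[of "1/2::real"] tendsto_const[of \<rho>]] \<rho> by simp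
  have "Cauchy u"
  proof (rule metric_CauchyI)
    fix e :: real assume "e > 0"
    then have "\<forall>\<^sub>F n in sequentially. (1/2) ^ n / \<rho> < e / 2"
      by (intro order_tendstoD(2)[OF lim0]) simp
    then obtain n where n: "(1/2) ^ n / \<rho> < e / 2" by (auto simp: eventually_sequentially)
    have "dist (u i) (u j) < e" if "i \<ge> Suc n" "j \<ge> Suc n" for i j
      using diam[OF u_le[OF that(1)]] diam[OF u_le[OF that(2)]] n
        dist_triangle3[of "u i" "u j" "u (Suc n)"] by linarith
    then show "\<exists>M. \<forall>i\<ge>M. \<forall>j\<ge>M. dist (u i) (u j) < e" by blast
  qed
  then obtain z where z: "u \<longlonglongrightarrow> z" using Cauchy_convergent convergent_def by blast
  \<comment> \<open>\<open>S (u n)\<close> is a sublevel set of a lower semicontinuous function and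
    contains the tail of \<open>u\<close>, hence also the limit.\<close>
  have z_S: "z \<in> S (u n)" for n
  proof -
    have "closed_function (\<lambda>y. \<phi> y + ereal (\<rho> * dist (u n) y))"
      by (intro closed_function_add_continuous closed not_MInf continuous_intros)
    moreover have "\<forall>\<^sub>F k in sequentially. \<phi> (u k) + ereal (\<rho> * dist (u n) (u k)) \<le> \<phi> (u n)"
      using eventually_ge_at_top[of n] by eventually_elim (use u_le in \<open>auto simp: S_def\<close>)
    ultimately show ?thesis using closed_function_limit_le[OF _ z] by (auto simp: S_def)
  qed
  show ?thesis
  proof
    show "\<phi> z + ereal (\<rho> * dist x0 z) \<le> \<phi> x0" using z_S[of 0] u0 by (simp add: S_def)
  next
    fix y assume "y \<noteq> z"
    \<comment> \<open>A point of \<open>S z\<close> lies in every \<open>S (u n)\<close>; these sets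
      shrink around \<open>u (Suc n)\<close>, so the point is the limit \<open>z\<close>
      itself.\<close>
    have "y \<notin> S z"
    proof
      assume "y \<in> S z"
      then have "dist (u (Suc n)) y \<le> (1/2) ^ n / \<rho>" for n
        using diam S_trans[OF u_fin z_S] by blast
      then have "(\<lambda>n. dist (u (Suc n)) y) \<longlonglongrightarrow> 0"
        by (intro Lim_null_comparison[OF _ lim0] always_eventually) auto
      then have "(\<lambda>n. u (Suc n)) \<longlonglongrightarrow> y" by (simp add: tendsto_dist_iff[of _ y])
      with LIMSEQ_Suc[OF z] have "z = y" by (rule LIMSEQ_unique)
      with \<open>y \<noteq> z\<close> show False by simp
    qed
    then show "\<phi> z < \<phi> y + ereal (\<rho> * dist z y)" by (simp add: S_def)
  qed
qed

section \<open>Bounds on the slope\<close>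

lemma slope_nonneg: "0 \<le> slope f u"
proof (cases "u islimpt UNIV")
  case True
  then have "at u \<noteq> bot" by (simp add: trivial_limit_within)
  moreover have "\<forall>\<^sub>F x in at u. 0 \<le> max 0 (f u - f x) / ereal (dist u x)"
    by (rule always_eventually) (simp add: zero_le_divide_ereal)
  ultimately show ?thesis using True
    unfolding slope_def by (auto intro!: le_Limsup)
qed (simp add: slope_def)

text \<open>The sign of \<open>c\<close> takes care of the positive part in the quotient and of
  isolated points, where the slope is \<open>0\<close> by convention.\<close>

lemma slope_le:
  assumes "0 \<le> c" and "\<forall>\<^sub>F y in at u. f u - f y \<le> ereal (c * dist u y)"
  shows "slope f u \<le> ereal c"
proof (cases "u islimpt UNIV")
  case True
  have "\<forall>\<^sub>F y in at u. max 0 (f u - f y) / ereal (dist u y) \<le> ereal c"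
    using assms(2) eventually_neq_at_within[of u u UNIV]
  proof eventually_elim
    case (elim y)
    have "max 0 (f u - f y) \<le> ereal c * ereal (dist u y)"
      using elim \<open>0 \<le> c\<close> by (simp add: zero_ereal_def)
    then show ?case using elim
      by (intro ereal_divide_le_pos[THEN iffD2]) (auto simp: mult.commute)
  qed
  then show ?thesis using True unfolding slope_def by (auto intro!: Limsup_bounded)
qed (use assms in \<open>simp add: slope_def\<close>)

section \<open>Growth functions and their one-sided derivative\<close>

lemma growth_function_continuous_dist:
  assumes "growth_function \<omega>"
  shows "continuous_on UNIV (\<lambda>y. \<omega> (dist y u))"
proof -
  have "continuous_on {0..} \<omega>"
    using assms by (auto simp: growth_function_def intro: differentiable_imp_continuous_on)
  then show ?thesis
    by (rule continuous_on_compose2) (auto intro!: continuous_intros)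
qed

lemma growth_function_deriv_nonneg:
  assumes "growth_function \<omega>" and "t \<ge> 0"
  shows "0 \<le> halfline_deriv \<omega> t"
  using assms by (cases "t = 0") (auto simp: growth_function_def intro: less_imp_le)

text \<open>First-order expansion at \<open>s\<close> with error rate \<open>\<delta>\<close>. Since
  the derivative is nonnegative, the signed increment may be replaced by
  \<open>\<bar>t - s\<bar>\<close>, a form that combines with the reverse triangle inequality for
  distances.\<close>

lemma growth_function_increment_le:
  assumes \<omega>: "growth_function \<omega>" and "s \<ge> 0" and "\<delta> > 0"
  obtains d where "d > 0"
    and "\<And>t. \<lbrakk>t \<ge> 0; \<bar>t - s\<bar> < d\<rbrakk> \<Longrightarrow> \<omega> t - \<omega> s \<le> (halfline_deriv \<omega> s + \<delta>) * \<bar>t - s\<bar>"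
proof -
  have "\<omega> differentiable (at s within {0..})"
    using \<omega> \<open>s \<ge> 0\<close> by (auto simp: growth_function_def differentiable_on_def)
  then have "(\<omega> has_vector_derivative halfline_deriv \<omega> s) (at s within {0..})"
    by (simp add: halfline_deriv_def vector_derivative_works)
  then have "(\<omega> has_derivative (\<lambda>h. h *\<^sub>R halfline_deriv \<omega> s)) (at s within {0..})"
    by (simp add: has_vector_derivative_def)
  then obtain d where d: "d > 0"
    "\<And>t. \<lbrakk>t \<ge> 0; \<bar>t - s\<bar> < d\<rbrakk> \<Longrightarrow> \<bar>\<omega> t - \<omega> s - (t - s) * halfline_deriv \<omega> s\<bar> \<le> \<delta> * \<bar>t - s\<bar>"
    using \<open>\<delta> > 0\<close> unfolding has_derivative_within_alt by force
  have "\<omega> t - \<omega> s \<le> (halfline_deriv \<omega> s + \<delta>) * \<bar>t - s\<bar>" if t: "t \<ge> 0" "\<bar>t - s\<bar> < d" for t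
  proof -
    have "(t - s) * halfline_deriv \<omega> s \<le> \<bar>t - s\<bar> * halfline_deriv \<omega> s"
      using growth_function_deriv_nonneg[OF \<omega> \<open>s \<ge> 0\<close>] by (intro mult_right_mono) auto
    then show ?thesis using d(2)[OF t] by (simp add: algebra_simps abs_le_iff)
  qed
  with d(1) show ?thesis using that by blast
qed

section \<open>Points of small slope near almost-minimizers\<close>

lemma almost_minimizer_near_small_slope:
  fixes f :: "'a::complete_space \<Rightarrow> ereal"
  assumes f: "closed_function f" "\<And>y. f y \<noteq> -\<infinity>" and fu: "\<bar>f u\<bar> \<noteq> \<infinity>"
    and \<omega>: "growth_function \<omega>" and \<rho>: "\<rho> > 0"
    and min: "\<And>y. f u - ereal \<eta> \<le> f y + ereal (\<omega> (dist y u))"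
  obtains z where "dist z u \<le> \<eta> / \<rho>" and "f z \<le> f u"
    and "slope f z \<le> ereal (2 * \<rho> + halfline_deriv \<omega> (dist z u))"
proof -
  define \<phi> where "\<phi> = (\<lambda>y. f y + ereal (\<omega> (dist y u)))"
  have \<omega>0: "\<omega> 0 = 0" and \<omega>_nonneg: "\<And>t. t \<ge> 0 \<Longrightarrow> 0 \<le> \<omega> t"
    using \<omega> by (auto simp: growth_function_def)
  obtain a where a: "f u = ereal a" using fu by (cases "f u") auto
  have "closed_function \<phi>"
    unfolding \<phi>_def by (intro closed_function_add_continuous f growth_function_continuous_dist \<omega>)
  moreover have "ereal (a - \<eta>) \<le> \<phi> y" for y using min[of y] a by (simp add: \<phi>_def)
  moreover have \<phi>u: "\<phi> u = ereal a" by (simp add: \<phi>_def a \<omega>0)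
  ultimately obtain z where z: "\<phi> z + ereal (\<rho> * dist u z) \<le> \<phi> u"
    and z_min: "\<And>y. y \<noteq> z \<Longrightarrow> \<phi> z < \<phi> y + ereal (\<rho> * dist z y)"
    using Ekeland_variational_principle[of \<phi> "a - \<eta>" u \<rho>] \<rho> by auto
  obtain b where b: "f z = ereal b"
    using z f(2)[of z] \<phi>u by (cases "f z") (auto simp: \<phi>_def)
  define s where "s = dist z u"
  \<comment> \<open>This inequality yields both estimates: against the lower bound
    \<open>a - \<eta>\<close> it gives \<open>\<rho> * s \<le> \<eta>\<close>, and dropping the
    nonnegative terms gives \<open>b \<le> a\<close>.\<close>
  have eq: "b + \<omega> s + \<rho> * s \<le> a" using z \<phi>u b by (simp add: \<phi>_def s_def dist_commute)
  have "a - \<eta> \<le> b + \<omega> s" using min[of z] a b by (simp add: s_def)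
  with eq have "dist z u \<le> \<eta> / \<rho>" using \<rho> by (simp add: s_def field_simps)
  moreover have "f z \<le> f u"
  proof -
    have "0 \<le> \<omega> s" "0 \<le> \<rho> * s" using \<omega>_nonneg \<rho> by (auto simp: s_def)
    with eq show ?thesis by (simp add: a b)
  qed
  \<comment> \<open>One \<open>\<rho>\<close> is the Ekeland rate; the other is the error allowed in
    the first-order expansion of \<open>\<omega>\<close> at \<open>s\<close>.\<close>
  moreover have "slope f z \<le> ereal (2 * \<rho> + halfline_deriv \<omega> s)"
  proof (rule slope_le)
    have deriv: "0 \<le> halfline_deriv \<omega> s"
      using growth_function_deriv_nonneg[OF \<omega>] by (simp add: s_def)
    with \<rho> show "0 \<le> 2 * \<rho> + halfline_deriv \<omega> s" by simp
    obtain d where d: "d > 0" "\<And>t. \<lbrakk>t \<ge> 0; \<bar>t - s\<bar> < d\<rbrakk> \<Longrightarrow>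
        \<omega> t - \<omega> s \<le> (halfline_deriv \<omega> s + \<rho>) * \<bar>t - s\<bar>"
      using growth_function_increment_le[OF \<omega> _ \<rho>, of s] by (auto simp: s_def)
    have "f z - f y \<le> ereal ((2 * \<rho> + halfline_deriv \<omega> s) * dist z y)"
      if y: "y \<noteq> z" "dist y z < d" for y
    proof (cases "f y")
      case (real c)
      define t where "t = dist y u"
      have ts: "\<bar>t - s\<bar> \<le> dist z y"
        using abs_dist_diff_le[of y u z] by (simp add: t_def s_def dist_commute)
      have "\<omega> t - \<omega> s \<le> (halfline_deriv \<omega> s + \<rho>) * \<bar>t - s\<bar>"
        using d(2)[of t] ts y by (simp add: t_def dist_commute)
      also have "\<dots> \<le> (halfline_deriv \<omega> s + \<rho>) * dist z y"
        using ts deriv \<rho> by (intro mult_left_mono) auto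
      finally have "\<omega> t - \<omega> s \<le> (halfline_deriv \<omega> s + \<rho>) * dist z y" .
      moreover have "b + \<omega> s < c + \<omega> t + \<rho> * dist z y"
        using z_min[OF y(1)] b real by (simp add: \<phi>_def s_def t_def)
      ultimately have "b - c \<le> (2 * \<rho> + halfline_deriv \<omega> s) * dist z y"
        by (simp add: algebra_simps)
      then show ?thesis using b real by simp
    qed (use b f(2)[of y] in auto)
    with d(1) show "\<forall>\<^sub>F y in at z. f z - f y \<le> ereal ((2 * \<rho> + halfline_deriv \<omega> s) * dist z y)"
      unfolding eventually_at by blast
  qed
  ultimately show ?thesis using that by (simp add: s_def)
qed

section \<open>The limiting slope along sequences\<close>

lemma limiting_slope_nonneg: "0 \<le> limiting_slope f u"
  unfolding limiting_slope_def by (intro Liminf_bounded always_eventually allI slope_nonneg)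

text \<open>Convergence of \<open>z\<close> and of its values is exactly convergence along the
  filter of the limiting slope, so a liminf above \<open>c\<close> would push the slopes above
  \<open>c\<close> eventually.\<close>

lemma limiting_slope_le:
  assumes z: "z \<longlonglongrightarrow> u" and fz: "(\<lambda>j. f (z j)) \<longlonglongrightarrow> f u"
    and le: "\<forall>\<^sub>F j in sequentially. slope f (z j) \<le> c"
  shows "limiting_slope f u \<le> c"
proof (rule ccontr)
  assume "\<not> limiting_slope f u \<le> c"
  then have "\<forall>\<^sub>F y in inf (nhds u) (filtercomap f (nhds (f u))). c < slope f y"
    unfolding limiting_slope_def by (intro less_LiminfD) simp
  moreover have "filterlim z (inf (nhds u) (filtercomap f (nhds (f u)))) sequentially"
    using z fz by (simp add: filterlim_inf filterlim_filtercomap_iff comp_def)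
  ultimately have "\<forall>\<^sub>F j in sequentially. c < slope f (z j)"
    by (rule eventually_compose_filterlim)
  with le have "\<forall>\<^sub>F j in sequentially. False" by eventually_elim auto
  then show False by simp
qed

text \<open>Properness controls the derivative only to the right of \<open>0\<close>, but
  \<open>t j\<close> may vanish, as when Ekeland's point is the starting point. There the value
  \<open>halfline_deriv \<omega> 0 = 0\<close> fills in.\<close>

lemma proper_growth_function_deriv_tendsto:
  assumes \<omega>: "proper_growth_function \<omega>" and t: "\<And>j. 0 \<le> t j" "t \<longlonglongrightarrow> 0"
  shows "(\<lambda>j. halfline_deriv \<omega> (t j)) \<longlonglongrightarrow> 0"
proof -
  \<comment> \<open>Composing with \<open>max 0\<close> extends the derivative to the left by its
    value at \<open>0\<close>, which makes two-sided continuity available and changes nothing at the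
    points \<open>t j\<close>.\<close>
  have "isCont (\<lambda>s. halfline_deriv \<omega> (max 0 s)) 0"
    unfolding continuous_at_split
  proof
    have d0: "halfline_deriv \<omega> 0 = 0"
      using \<omega> by (simp add: proper_growth_function_def growth_function_def)
    show "continuous (at_left 0) (\<lambda>s. halfline_deriv \<omega> (max 0 s))"
      unfolding continuous_within
      by (rule tendsto_eventually) (auto simp: eventually_at_filter)
    have "(halfline_deriv \<omega> \<longlongrightarrow> 0) (at_right 0)"
      using \<omega> by (simp add: proper_growth_function_def)
    then show "continuous (at_right 0) (\<lambda>s. halfline_deriv \<omega> (max 0 s))"
      unfolding continuous_within max.idem d0
      by (rule Lim_transform_eventually) (auto simp: max_def eventually_at_filter)
  qed
  from isCont_tendsto_compose[OF this t(2)] show ?thesis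
    using \<omega> t(1) by (simp add: max_def proper_growth_function_def growth_function_def)
qed

section \<open>Stationarity of limit points\<close>

theorem corollary5p6:
  fixes f :: "'a::complete_space \<Rightarrow> ereal"
    and x :: "nat \<Rightarrow> 'a"
    and fm :: "nat \<Rightarrow> 'a \<Rightarrow> ereal"
    and \<epsilon> :: "nat \<Rightarrow> real"
    and \<omega> :: "real \<Rightarrow> real"
    and xstar :: 'a
  assumes "\<And>y. f y \<noteq> -\<infinity>"
    and "closed_function f"
    and "\<And>k. \<bar>f (x k)\<bar> \<noteq> \<infinity>"
    and "\<And>k y. fm k y \<noteq> -\<infinity>"
    and "\<And>k. closed_function (fm k)"
    and "\<And>k. fm k (x (Suc k)) \<le> (INF y. fm k y) + ereal (\<epsilon> k)"
    and "\<epsilon> \<longlonglongrightarrow> 0"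
    and "proper_growth_function \<omega>"
    and "\<And>k y. (fm k y = \<infinity> \<and> f y = \<infinity>) \<or>
           (\<bar>fm k y\<bar> \<noteq> \<infinity> \<and> \<bar>f y\<bar> \<noteq> \<infinity> \<and> \<bar>fm k y - f y\<bar> \<le> ereal (\<omega> (dist y (x k))))"
    and "(\<lambda>k. f (x k) - fm k (x (Suc k))) \<longlonglongrightarrow> 0"
    and "\<bar>f xstar\<bar> \<noteq> \<infinity>"
    and "\<exists>r. strict_mono r \<and> (\<lambda>j. (x (r j), f (x (r j)))) \<longlonglongrightarrow> (xstar, f xstar)"
  shows "stationary f xstar"
proof -
  have growth: "growth_function \<omega>"
    using assms(8) by (simp add: proper_growth_function_def)
  \<comment> \<open>\<open>\<eta> k\<close> is the model improvement plus the inexactness of the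
    model step. The conversion to a real loses nothing, as both values in the difference turn out to
    be finite.\<close>
  define \<eta> where "\<eta> = (\<lambda>k. real_of_ereal (f (x k) - fm k (x (Suc k))) + \<epsilon> k)"
  have "(\<lambda>k. real_of_ereal (f (x k) - fm k (x (Suc k)))) \<longlonglongrightarrow> 0"
    using lim_real_of_ereal[of _ 0] assms(10) by (simp add: zero_ereal_def)
  from tendsto_add[OF this assms(7)] have \<eta>: "\<eta> \<longlonglongrightarrow> 0" by (simp add: \<eta>_def)
  have almost_min: "f (x k) - ereal (\<eta> k) \<le> f y + ereal (\<omega> (dist y (x k)))" for k y
  proof -
    have upper: "fm k (x (Suc k)) \<le> fm k w + ereal (\<epsilon> k)" for w
      using assms(6)[of k] by (rule order_trans) (intro add_right_mono INF_lower, simp)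
    \<comment> \<open>The model is finite at \<open>x k\<close> because \<open>f\<close> is;
      near-optimality then excludes the value \<open>\<infinity>\<close> at
      \<open>x (Suc k)\<close>.\<close>
    have "fm k (x k) \<noteq> \<infinity>" using assms(9)[of k "x k"] assms(3)[of k] by auto
    with upper[of "x k"] have "fm k (x (Suc k)) \<noteq> \<infinity>" by auto
    with assms(3)[of k] assms(4)[of k "x (Suc k)"]
    have eq: "f (x k) - ereal (\<eta> k) = fm k (x (Suc k)) - ereal (\<epsilon> k)"
      by (cases "f (x k)"; cases "fm k (x (Suc k))") (auto simp: \<eta>_def)
    have "fm k (x (Suc k)) - ereal (\<epsilon> k) \<le> fm k y"
      using upper[of y] by (simp add: ereal_minus_le)
    also have "fm k y \<le> f y + ereal (\<omega> (dist y (x k)))"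
      using assms(9)[of k y] by (cases "fm k y"; cases "f y") auto
    finally show ?thesis unfolding eq .
  qed
  obtain r where r: "strict_mono r"
    and "(\<lambda>j. (x (r j), f (x (r j)))) \<longlonglongrightarrow> (xstar, f xstar)"
    using assms(12) by blast
  from tendsto_fst[OF this(2)] tendsto_snd[OF this(2)]
  have xr: "(\<lambda>j. x (r j)) \<longlonglongrightarrow> xstar" and fxr: "(\<lambda>j. f (x (r j))) \<longlonglongrightarrow> f xstar" by auto
  have "limiting_slope f xstar \<le> 0 + ereal e" if "e > 0" for e
  proof -
    \<comment> \<open>The slope bound has the two terms \<open>2 * \<rho>\<close> and the derivative
      of \<open>\<omega>\<close>, which is eventually below \<open>\<rho>\<close>; together they
      stay below \<open>e\<close>.\<close>
    define \<rho> where "\<rho> = e / 3"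
    have \<rho>: "\<rho> > 0" using that by (simp add: \<rho>_def)
    have "\<exists>z. dist z (x k) \<le> \<eta> k / \<rho> \<and> f z \<le> f (x k) \<and>
        slope f z \<le> ereal (2 * \<rho> + halfline_deriv \<omega> (dist z (x k)))" for k
      using almost_minimizer_near_small_slope[OF assms(2,1,3) growth \<rho> almost_min] by metis
    then obtain z where z_dist: "\<And>k. dist (z k) (x k) \<le> \<eta> k / \<rho>"
      and fz_le: "\<And>k. f (z k) \<le> f (x k)"
      and z_slope: "\<And>k. slope f (z k) \<le> ereal (2 * \<rho> + halfline_deriv \<omega> (dist (z k) (x k)))"
      by metis
    have "(\<lambda>k. \<eta> k / \<rho>) \<longlonglongrightarrow> 0" using tendsto_divide[OF \<eta> tendsto_const] \<rho> by auto
    then have "(\<lambda>k. dist (z k) (x k)) \<longlonglongrightarrow> 0"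
      by (rule Lim_null_comparison[rotated]) (simp add: z_dist)
    from LIMSEQ_subseq_LIMSEQ[OF this r]
    have dist_r: "(\<lambda>j. dist (z (r j)) (x (r j))) \<longlonglongrightarrow> 0" by (simp add: comp_def)
    have zr: "(\<lambda>j. z (r j)) \<longlonglongrightarrow> xstar"
    proof (rule metric_tendsto_imp_tendsto)
      show "(\<lambda>j. dist (z (r j)) (x (r j)) + dist (x (r j)) xstar) \<longlonglongrightarrow> (0::real)"
        using tendsto_add[OF dist_r tendsto_dist[OF xr tendsto_const[of xstar]]] by simp
      show "\<forall>\<^sub>F j in sequentially. dist (z (r j)) xstar \<le>
          dist (dist (z (r j)) (x (r j)) + dist (x (r j)) xstar) 0"
        by (rule always_eventually) (simp add: dist_triangle)
    qed
    \<comment> \<open>Lower semicontinuity at \<open>xstar\<close> bounds these values from below;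
      from above they are bounded by \<open>f (x (r j))\<close>, which converges to
      \<open>f xstar\<close>.\<close>
    have "(\<lambda>j. f (z (r j))) \<longlonglongrightarrow> f xstar"
    proof (rule order_tendstoI)
      fix c assume "c < f xstar"
      then have "\<forall>\<^sub>F y in nhds xstar. c < f y"
        using assms(2) unfolding closed_function_iff by blast
      then show "\<forall>\<^sub>F j in sequentially. c < f (z (r j))"
        using zr by (rule eventually_compose_filterlim)
    next
      fix c assume "f xstar < c"
      from order_tendstoD(2)[OF fxr this] show "\<forall>\<^sub>F j in sequentially. f (z (r j)) < c"
        by eventually_elim (rule le_less_trans[OF fz_le])
    qed
    moreover have "\<forall>\<^sub>F j in sequentially. slope f (z (r j)) \<le> ereal e"
    proof -
      have "\<forall>\<^sub>F j in sequentially. halfline_deriv \<omega> (dist (z (r j)) (x (r j))) < \<rho>"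
        using proper_growth_function_deriv_tendsto[OF assms(8) _ dist_r] \<rho>
        by (auto dest: order_tendstoD(2))
      then show ?thesis
      proof eventually_elim
        case (elim j)
        show ?case
          by (rule order_trans[OF z_slope]) (use elim in \<open>simp add: \<rho>_def\<close>)
      qed
    qed
    ultimately show ?thesis using limiting_slope_le[OF zr] by simp
  qed
  then have "limiting_slope f xstar \<le> 0" by (rule ereal_le_epsilon2)
  with limiting_slope_nonneg[of f xstar] assms(11) show ?thesis
    by (simp add: stationary_def)
qed

end
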